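(* Let $p$ be a prime, let $m$ be a positive integer divisible by $3$, let $n=\frac m3(p-1)$ and $U=[0,n]^2$. Let $i$ be an integer with $0\le i\le n$, let $J_{i+1},\dots,J_n$ be a backward consistent sequence of ideals of $U$, and let $J_i$ be an ideal of $U$. Then $J_i$ is consistent with $J_{i+1},\dots,J_n$ if and only if the following conditions hold: (i) $J_i\supseteq J_{i+1}$; (ii) $\bigl[J_i+D-(0,p)\bigr]\cap U\subseteq J_{i+1}$; (iii) $\bigl[J_{i+p}+D+(1,0)\bigr]\cap U\subseteq J_i$ (this condition is void if $i+p>n$); (iv) if there exists an integer $\alpha$ with $1\le\alpha\le p-1$, $i+\alpha\le n$ and $J_{i+\alpha}\neq\emptyset$, then, letting $\alpha_i$ be the largest such integer, $\bigl[J_{i+\alpha_i}+D+(1,-p^2+p\alpha_i)\bigr]\cap U\subseteq J_i$ (if no such $\alpha$ exists, this condition is void).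
   Context: $D=\{(x,y)\in\mathbb{R}^2: x+py\le 0,\ p^2x+y\le 0\}$ and $\Delta=\{(x,y,z)\in\mathbb{R}^3: x+py+p^2z\le 0,\ p^2x+y+pz\le 0,\ px+p^2y+z\le 0\}$. For $u,v\in\mathbb{R}^2$, $u\prec v$ means $u\in v+D$; for $u,v\in\mathbb{R}^3$, $u\prec v$ means $u\in v+\Delta$. For $\Omega\subseteq\mathbb{R}^2$ or $\mathbb{R}^3$, an ideal of $\Omega$ is a subset $I\subseteq\Omega$ such that $u\in I$, $v\in\Omega$, $v\prec u$ imply $v\in I$. For integers $a\le b$, $[a,b]=\{x\in\mathbb{Z}:a\le x\le b\}$. Sums like $J+D+(a,b)$ are Minkowski sums in $\mathbb{R}^2$. A sequence $J_{i+1},\dots,J_n$ of ideals of $U$ is backward consistent if $\bigcup_{j=i+1}^n(J_j\times\{j\})$ is an ideal of $U\times[i+1,n]$ (with respect to $\prec$ on $\mathbb{R}^3$); $J_i$ is consistent with $J_{i+1},\dots,J_n$ if $J_i,J_{i+1},\dots,J_n$ is backward consistent. *)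

theory Defs
  imports
    Complex_Main
    "HOL-Library.Set_Algebras"
    "HOL-Library.Product_Plus"
    "HOL-Computational_Algebra.Primes"
begin

text \<open>
  The plane is \<^typ>\<open>real \<times> real\<close>, and three-space is \<^typ>\<open>(real \<times> real) \<times> real\<close>, so that
  the Cartesian product of a planar set with a set of reals is a subset of three-space.
  Sums of sets are Minkowski sums (HOL-Library.Set_Algebras); a translation is written as the
  sum with a singleton, because \<open>-\<close> on sets is set difference.
\<close>

definition D_cone :: "nat \<Rightarrow> (real \<times> real) set" where
  "D_cone p = {(x, y). x + real p * y \<le> 0 \<and> (real p)^2 * x + y \<le> 0}"

definition Delta_cone :: "nat \<Rightarrow> ((real \<times> real) \<times> real) set" where
  "Delta_cone p = {((x, y), z).
     x + real p * y + (real p)^2 * z \<le> 0 \<and>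
     (real p)^2 * x + y + real p * z \<le> 0 \<and>
     real p * x + (real p)^2 * y + z \<le> 0}"

text \<open>The relation \<open>u \<prec> v\<close> determined by the cone \<open>C\<close>; it is not strict.\<close>

definition prec :: "'a::plus set \<Rightarrow> 'a \<Rightarrow> 'a \<Rightarrow> bool" where
  "prec C u v \<longleftrightarrow> u \<in> {v} + C"

definition is_ideal :: "'a::plus set \<Rightarrow> 'a set \<Rightarrow> 'a set \<Rightarrow> bool" where
  "is_ideal C \<Omega> I \<longleftrightarrow> I \<subseteq> \<Omega> \<and> (\<forall>u\<in>I. \<forall>v\<in>\<Omega>. prec C v u \<longrightarrow> v \<in> I)"

text \<open>The integer interval \<open>[a, b]\<close>, as a set of reals.\<close>

definition int_interval :: "int \<Rightarrow> int \<Rightarrow> real set" where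
  "int_interval a b = real_of_int ` {a..b}"

definition U_square :: "int \<Rightarrow> (real \<times> real) set" where
  "U_square n = int_interval 0 n \<times> int_interval 0 n"

text \<open>
  \<open>backward_consistent p n k J\<close> is about the sequence \<open>J k, \<dots>, J n\<close> only; the values of \<open>J\<close>
  at other indices are irrelevant. The sequence is empty for \<open>k = n + 1\<close>.
\<close>

definition backward_consistent ::
    "nat \<Rightarrow> int \<Rightarrow> int \<Rightarrow> (int \<Rightarrow> (real \<times> real) set) \<Rightarrow> bool" where
  "backward_consistent p n k J \<longleftrightarrow>
     (\<forall>j\<in>{k..n}. is_ideal (D_cone p) (U_square n) (J j)) \<and>
     is_ideal (Delta_cone p) (U_square n \<times> int_interval k n)
       (\<Union>j\<in>{k..n}. J j \<times> {real_of_int j})"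

text \<open>\<open>J i\<close> is consistent with \<open>J (i + 1), \<dots>, J n\<close>.\<close>

definition consistent_at ::
    "nat \<Rightarrow> int \<Rightarrow> int \<Rightarrow> (int \<Rightarrow> (real \<times> real) set) \<Rightarrow> bool" where
  "consistent_at p n i J \<longleftrightarrow> backward_consistent p n i J"

end

theory Submission
  imports Defs
begin

text \<open>
  All points of \<open>U\<close> are integral, so the theorem is about integer inequalities. For the
  nontrivial direction, a relation \<open>v \<prec> u\<close> between two levels, one of which is \<open>i\<close>, is
  factored through a lattice point \<open>w\<close> of \<open>U\<close> on a level above \<open>i\<close>, so that one factor is covered
  by the consistency of \<open>J (i + 1), \<dots>, J n\<close> and the other by one of the four conditions. The
  only delicate point is to keep \<open>w\<close> inside the square: when the canonical choice
  (\<open>u - (0, p)\<close> on level \<open>i + 1\<close>, or \<open>v - (1, 0)\<close> on level \<open>i + p\<close>) leaves it, \<open>w\<close> is shifted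
  by a multiple of the boundary vector \<open>(- p, 1)\<close> of \<open>D\<close>, or, on level \<open>i + p\<close>, already \<open>w = v\<close>
  works.
\<close>

section \<open>Integral form of the cones, the translated ideals and consistency\<close>

definition D_int :: "int \<Rightarrow> int \<Rightarrow> int \<Rightarrow> bool" where
  "D_int p x y \<longleftrightarrow> x + p * y \<le> 0 \<and> p^2 * x + y \<le> 0"

definition Delta_int :: "int \<Rightarrow> int \<Rightarrow> int \<Rightarrow> int \<Rightarrow> bool" where
  "Delta_int p x y z \<longleftrightarrow>
     x + p * y + p^2 * z \<le> 0 \<and> p^2 * x + y + p * z \<le> 0 \<and> p * x + p^2 * y + z \<le> 0"

abbreviation ipt :: "int \<Rightarrow> int \<Rightarrow> real \<times> real" where
  "ipt x y \<equiv> (real_of_int x, real_of_int y)"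

lemma ipt_in_D_cone_iff: "ipt x y \<in> D_cone p \<longleftrightarrow> D_int (int p) x y"
proof -
  have "x + int p * y \<le> 0 \<longleftrightarrow> real_of_int x + real p * real_of_int y \<le> 0"
    using of_int_le_0_iff[where 'a = real, of "x + int p * y"] by simp
  moreover have "(int p)^2 * x + y \<le> 0 \<longleftrightarrow> (real p)^2 * real_of_int x + real_of_int y \<le> 0"
    using of_int_le_0_iff[where 'a = real, of "(int p)^2 * x + y"] by simp
  ultimately show ?thesis by (simp add: D_cone_def D_int_def)
qed

lemma ipt_in_Delta_cone_iff:
  "(ipt x y, real_of_int z) \<in> Delta_cone p \<longleftrightarrow> Delta_int (int p) x y z"
proof -
  let ?x = "real_of_int x" and ?y = "real_of_int y" and ?z = "real_of_int z" and ?p = "real p"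
  have "x + int p * y + (int p)^2 * z \<le> 0 \<longleftrightarrow> ?x + ?p * ?y + ?p^2 * ?z \<le> 0"
    using of_int_le_0_iff[where 'a = real, of "x + int p * y + (int p)^2 * z"] by simp
  moreover have "(int p)^2 * x + y + int p * z \<le> 0 \<longleftrightarrow> ?p^2 * ?x + ?y + ?p * ?z \<le> 0"
    using of_int_le_0_iff[where 'a = real, of "(int p)^2 * x + y + int p * z"] by simp
  moreover have "int p * x + (int p)^2 * y + z \<le> 0 \<longleftrightarrow> ?p * ?x + ?p^2 * ?y + ?z \<le> 0"
    using of_int_le_0_iff[where 'a = real, of "int p * x + (int p)^2 * y + z"] by simp
  ultimately show ?thesis by (simp add: Delta_cone_def Delta_int_def)
qed

lemma prec_iff_diff: "prec C u v \<longleftrightarrow> u - v \<in> C" for u v :: "'a::ab_group_add"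
  unfolding prec_def set_plus_def
  by (auto simp: algebra_simps)
    (metis add_diff_cancel_left' diff_add_cancel add.commute)

lemma prec_D_cone_iff: "prec (D_cone p) (ipt c d) (ipt a b) \<longleftrightarrow> D_int (int p) (c - a) (d - b)"
  by (simp add: prec_iff_diff flip: ipt_in_D_cone_iff)

lemma prec_Delta_cone_iff:
  "prec (Delta_cone p) (ipt c d, real_of_int l) (ipt a b, real_of_int k)
     \<longleftrightarrow> Delta_int (int p) (c - a) (d - b) (l - k)"
  by (simp add: prec_iff_diff flip: ipt_in_Delta_cone_iff)

lemma ipt_in_U_square_iff: "ipt x y \<in> U_square n \<longleftrightarrow> x \<in> {0..n} \<and> y \<in> {0..n}"
  unfolding U_square_def int_interval_def by auto

lemma U_squareE:
  assumes "u \<in> U_square n"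
  obtains x y where "u = ipt x y"
  using assms unfolding U_square_def int_interval_def by auto

text \<open>Conditions (ii) to (iv) all have this shape. Since \<open>A\<close> consists of lattice
  points and the offset is integral, a vector of the real cone that leads to a lattice point is
  itself integral.\<close>

lemma translate_subset_iff:
  assumes "A \<subseteq> U_square n"
  shows "(A + D_cone p + {ipt e f}) \<inter> U_square n \<subseteq> B \<longleftrightarrow>
    (\<forall>a b c d. ipt a b \<in> A \<longrightarrow> ipt c d \<in> U_square n \<longrightarrow> D_int (int p) (c - a - e) (d - b - f)
       \<longrightarrow> ipt c d \<in> B)"
proof -
  have *: "ipt c d \<in> A + D_cone p + {ipt e f} \<longleftrightarrow>
      (\<exists>a b. ipt a b \<in> A \<and> D_int (int p) (c - a - e) (d - b - f))" for c d
  proof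
    assume "ipt c d \<in> A + D_cone p + {ipt e f}"
    then obtain u v where uv: "u \<in> A" "v \<in> D_cone p" "ipt c d = u + v + ipt e f"
      by (auto elim!: set_plus_elim)
    moreover obtain a b where u: "u = ipt a b" using uv(1) assms by (blast elim: U_squareE)
    moreover have "v = ipt (c - a - e) (d - b - f)" using uv(3) u by (cases v) simp
    ultimately show "\<exists>a b. ipt a b \<in> A \<and> D_int (int p) (c - a - e) (d - b - f)"
      using ipt_in_D_cone_iff by metis
  next
    assume "\<exists>a b. ipt a b \<in> A \<and> D_int (int p) (c - a - e) (d - b - f)"
    then obtain a b where ab: "ipt a b \<in> A" "ipt (c - a - e) (d - b - f) \<in> D_cone p"
      unfolding ipt_in_D_cone_iff by blast
    have "ipt a b + ipt (c - a - e) (d - b - f) + ipt e f \<in> A + D_cone p + {ipt e f}"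
      using ab by (intro set_plus_intro) auto
    then show "ipt c d \<in> A + D_cone p + {ipt e f}" by simp
  qed
  show ?thesis
  proof
    assume "(A + D_cone p + {ipt e f}) \<inter> U_square n \<subseteq> B"
    then show "\<forall>a b c d. ipt a b \<in> A \<longrightarrow> ipt c d \<in> U_square n \<longrightarrow>
        D_int (int p) (c - a - e) (d - b - f) \<longrightarrow> ipt c d \<in> B"
      using * by blast
  next
    assume R: "\<forall>a b c d. ipt a b \<in> A \<longrightarrow> ipt c d \<in> U_square n \<longrightarrow>
        D_int (int p) (c - a - e) (d - b - f) \<longrightarrow> ipt c d \<in> B"
    show "(A + D_cone p + {ipt e f}) \<inter> U_square n \<subseteq> B"
    proof
      fix v assume v: "v \<in> (A + D_cone p + {ipt e f}) \<inter> U_square n"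
      then obtain c d where "v = ipt c d" by (blast elim: U_squareE)
      with v R * show "v \<in> B" by blast
    qed
  qed
qed

text \<open>The slices of the union are recovered from it because \<open>real_of_int\<close> is
  injective, so the ideal property in space splits into one statement for each pair of levels
  \<open>j\<close>, \<open>l\<close>.\<close>

lemma backward_consistent_iff:
  "backward_consistent p n k J \<longleftrightarrow>
    (\<forall>j\<in>{k..n}. is_ideal (D_cone p) (U_square n) (J j)) \<and>
    (\<forall>j\<in>{k..n}. \<forall>l\<in>{k..n}. \<forall>a b c d. ipt a b \<in> J j \<longrightarrow> ipt c d \<in> U_square n \<longrightarrow>
       Delta_int (int p) (c - a) (d - b) (l - j) \<longrightarrow> ipt c d \<in> J l)"
proof -
  let ?I = "\<Union>j\<in>{k..n}. J j \<times> {real_of_int j}"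
  let ?V = "U_square n \<times> int_interval k n"
  have mem: "(u, real_of_int j) \<in> ?I \<longleftrightarrow> j \<in> {k..n} \<and> u \<in> J j" for u j by auto
  have ideal_iff: "is_ideal (Delta_cone p) ?V ?I \<longleftrightarrow>
      (\<forall>j\<in>{k..n}. \<forall>l\<in>{k..n}. \<forall>a b c d. ipt a b \<in> J j \<longrightarrow> ipt c d \<in> U_square n \<longrightarrow>
       Delta_int (int p) (c - a) (d - b) (l - j) \<longrightarrow> ipt c d \<in> J l)" (is "_ \<longleftrightarrow> ?R")
    if sub: "\<forall>j\<in>{k..n}. J j \<subseteq> U_square n"
  proof
    assume L: "is_ideal (Delta_cone p) ?V ?I"
    show ?R
    proof (intro ballI allI impI)
      fix j l a b c d
      assume H: "j \<in> {k..n}" "l \<in> {k..n}" "ipt a b \<in> J j" "ipt c d \<in> U_square n"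
        "Delta_int (int p) (c - a) (d - b) (l - j)"
      have "(ipt a b, real_of_int j) \<in> ?I" using H mem by blast
      moreover have "(ipt c d, real_of_int l) \<in> ?V" using H by (simp add: int_interval_def)
      moreover have "prec (Delta_cone p) (ipt c d, real_of_int l) (ipt a b, real_of_int j)"
        using H prec_Delta_cone_iff by blast
      ultimately have "(ipt c d, real_of_int l) \<in> ?I" using L unfolding is_ideal_def by blast
      then show "ipt c d \<in> J l" using mem by blast
    qed
  next
    assume R: ?R
    show "is_ideal (Delta_cone p) ?V ?I"
      unfolding is_ideal_def
    proof (intro conjI ballI impI)
      show "?I \<subseteq> ?V" using sub by (auto simp: int_interval_def)
    next
      fix x y assume x: "x \<in> ?I" and y: "y \<in> ?V" and xy: "prec (Delta_cone p) y x"
      from x obtain j u where j: "j \<in> {k..n}" "u \<in> J j" "x = (u, real_of_int j)" by auto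
      then obtain a b where u: "u = ipt a b" using sub by (blast elim: U_squareE)
      from y obtain v l where l: "l \<in> {k..n}" "v \<in> U_square n" "y = (v, real_of_int l)"
        unfolding int_interval_def by auto
      then obtain c d where v: "v = ipt c d" by (blast elim: U_squareE)
      have "Delta_int (int p) (c - a) (d - b) (l - j)"
        using xy unfolding j(3) l(3) u v prec_Delta_cone_iff .
      then have "ipt c d \<in> J l" using R j l u v by blast
      then show "y \<in> ?I" using l v mem by blast
    qed
  qed
  show ?thesis
    unfolding backward_consistent_def
  proof (rule conj_cong[OF refl ideal_iff])
    assume "\<forall>j\<in>{k..n}. is_ideal (D_cone p) (U_square n) (J j)"
    then show "\<forall>j\<in>{k..n}. J j \<subseteq> U_square n" unfolding is_ideal_def by blast
  qed
qed

section \<open>Arithmetic of the integral cones and factorization through intermediate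
  points\<close>

context
  fixes p :: int
  assumes p_ge_1: "p \<ge> 1"
begin

lemma p_pos: "p > 0"
  using p_ge_1 by simp

lemma p_power_ge_1: "p ^ k \<ge> 1"
  using p_ge_1 by simp

lemma mult_power_ge: "x \<ge> 0 \<Longrightarrow> x \<le> p ^ k * x"
  using mult_right_mono[OF p_power_ge_1[of k], of x] by simp

text \<open>Going down, the third inequality of the cone implies the first:
  \<open>t \<le> p^3 * t\<close>, and a factor \<open>p\<close> cancels.\<close>

lemma Delta_int_down_iff:
  assumes "t \<ge> 0"
  shows "Delta_int p x y (- t) \<longleftrightarrow> p^2 * x + y \<le> p * t \<and> p * (x + p * y) \<le> t"
proof -
  have "x + p * y \<le> p^2 * t" if "p * (x + p * y) \<le> t"
  proof -
    have "p * (x + p * y) \<le> p * (p^2 * t)"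
      using that mult_power_ge[OF assms, of 3] by (simp add: power2_eq_square power3_eq_cube)
    then show ?thesis using p_ge_1 by simp
  qed
  then show ?thesis unfolding Delta_int_def by (auto simp: algebra_simps power2_eq_square)
qed

text \<open>Going up, the first inequality times \<open>p\<close> implies the third, again by
  \<open>t \<le> p^3 * t\<close>.\<close>

lemma Delta_int_up_iff:
  assumes "t \<ge> 0"
  shows "Delta_int p x y t \<longleftrightarrow> x + p * y + p^2 * t \<le> 0 \<and> p^2 * x + y + p * t \<le> 0"
proof -
  have "p * x + p^2 * y + t \<le> 0" if "x + p * y + p^2 * t \<le> 0"
  proof -
    have "p * (x + p * y + p^2 * t) \<le> 0"
      using that p_ge_1 by (simp add: mult_nonneg_nonpos)
    then show ?thesis using mult_power_ge[OF assms, of 3]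
      by (simp add: algebra_simps power2_eq_square power3_eq_cube)
  qed
  then show ?thesis unfolding Delta_int_def by auto
qed

lemma Delta_int_level_iff: "Delta_int p x y 0 \<longleftrightarrow> D_int p x y"
  using Delta_int_up_iff[of 0] by (simp add: D_int_def)

lemma Delta_int_descend: "t \<ge> 0 \<Longrightarrow> Delta_int p 0 0 (- t)"
  using p_ge_1 by (simp add: Delta_int_down_iff)

text \<open>For \<open>t = 1\<close> the two upward inequalities are literally those of
  \<open>D\<close> translated by \<open>(0, - p)\<close>.\<close>

lemma Delta_int_condition_ii: "D_int p x (y + p) \<Longrightarrow> Delta_int p x y 1"
  by (simp add: D_int_def Delta_int_up_iff algebra_simps power2_eq_square)

text \<open>The vector \<open>(1, 0, - p)\<close> turns both downward inequalities into equalities;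
  a vector of \<open>D\<close> is then added in the plane.\<close>

lemma Delta_int_condition_iii:
  assumes "D_int p (x - 1) y"
  shows "Delta_int p x y (- p)"
proof -
  have "p * (x - 1 + p * y) \<le> 0"
    using assms p_ge_1 unfolding D_int_def by (intro mult_nonneg_nonpos) auto
  then show ?thesis
    using assms p_ge_1
    by (simp add: Delta_int_down_iff) (simp add: D_int_def algebra_simps power2_eq_square)
qed

text \<open>The offset is chosen to make the second inequality of the cone an equality. In the third
  it leaves \<open>(p^3 - 1) * (\<alpha> - p)\<close>, which has the right sign for
  \<open>\<alpha> \<le> p\<close>.\<close>

lemma Delta_int_condition_iv:
  assumes "0 \<le> \<alpha>" "\<alpha> \<le> p" "D_int p (x - 1) (y - (- (p^2) + p * \<alpha>))"
  shows "Delta_int p x y (- \<alpha>)"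
proof -
  have "p * (x - 1 + p * (y - (- (p^2) + p * \<alpha>))) \<le> 0"
    using assms p_ge_1 unfolding D_int_def by (intro mult_nonneg_nonpos) auto
  moreover have "(p^3 - 1) * (\<alpha> - p) \<le> 0"
    using assms p_pos p_power_ge_1[of 3] by (intro mult_nonneg_nonpos) auto
  ultimately have "p * (x + p * y) \<le> \<alpha>"
    by (simp add: algebra_simps power2_eq_square power3_eq_cube)
  then show ?thesis
    using assms by (simp add: Delta_int_down_iff) (simp add: D_int_def algebra_simps power2_eq_square)
qed

text \<open>Splits off one level: condition (ii) covers the step to \<open>(a', b')\<close>, and the
  remaining rise \<open>t - 1\<close> takes place among the higher levels. The choice
  \<open>(a, b - p)\<close> loses nothing, because the upward inequalities for \<open>t\<close>
  become those for \<open>t - 1\<close>.\<close>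

lemma factor_up:
  assumes "t \<ge> 1" "0 \<le> a" "0 \<le> b" "0 \<le> c" "0 \<le> d" and Delta: "Delta_int p (c - a) (d - b) t"
  obtains a' b' where "0 \<le> a'" "a' \<le> a" "0 \<le> b'" "b' \<le> b"
    "D_int p (a' - a) (b' - b + p)" "Delta_int p (c - a') (d - b') (t - 1)"
proof -
  have 1: "c - a + p * (d - b) + p^2 * t \<le> 0" and 2: "p^2 * (c - a) + (d - b) + p * t \<le> 0"
    using Delta assms(1) by (auto simp: Delta_int_up_iff)
  show thesis
  proof (cases "p \<le> b")
    case True
    show thesis
    proof (rule that[of a "b - p"])
      show "Delta_int p (c - a) (d - (b - p)) (t - 1)"
        using 1 2 assms(1) by (simp add: Delta_int_up_iff algebra_simps power2_eq_square)
    qed (use True p_ge_1 assms in \<open>auto simp: D_int_def\<close>)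
  next
    case False
    \<comment> \<open>Adding \<open>s\<close> copies of \<open>(- p, 1)\<close> lifts the second
      coordinate \<open>b - p\<close> exactly to 0.\<close>
    define s where "s = p - b"
    have s: "s \<ge> 1" using False s_def by simp
    define x where "x = c - (a - p * s)"
    have x: "x \<le> - (p * d) - p^2 * (t - 1)"
      using 1 by (simp add: x_def s_def algebra_simps power2_eq_square)
    have "p * d \<ge> 0" "p^2 * (t - 1) \<ge> 0" using assms p_ge_1 by simp_all
    \<comment> \<open>Since \<open>a - p * s = c - x\<close>, this keeps the first coordinate of the
      shifted point nonnegative.\<close>
    with x have "x \<le> 0" by linarith
    have "p^2 * x \<le> p^2 * (- (p * d) - p^2 * (t - 1))"
      using x by (intro mult_left_mono) auto
    moreover have "d \<le> p^3 * d" using assms mult_power_ge by simp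
    moreover have "p * (t - 1) \<le> p^3 * (p * (t - 1))"
      using assms p_ge_1 by (intro mult_power_ge) simp
    ultimately have "p^2 * x + d + p * (t - 1) \<le> 0"
      by (simp add: algebra_simps power2_eq_square power3_eq_cube)
    then have *: "Delta_int p x d (t - 1)"
      using x assms(1) by (simp add: Delta_int_up_iff)
    have "s \<le> p^3 * s" using s mult_power_ge by simp
    then have **: "D_int p (- (p * s)) s"
      by (simp add: D_int_def power2_eq_square power3_eq_cube algebra_simps)
    show thesis
    proof (rule that[of "a - p * s" 0])
      show "0 \<le> a - p * s" using \<open>x \<le> 0\<close> assms unfolding x_def by simp
      show "a - p * s \<le> a" using s p_ge_1 by simp
      show "D_int p (a - p * s - a) (0 - b + p)" using ** by (simp add: s_def)
      show "Delta_int p (c - (a - p * s)) (d - 0) (t - 1)" using * by (simp add: x_def)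
    qed (use assms in auto)
  qed
qed

text \<open>Stops at height \<open>p\<close> above the target level. From there, condition (iii)
  covers the rest, or a vertical descent does if the two points coincide. The choice
  \<open>(c - 1, d)\<close> leaves the square only for \<open>c = 0\<close>.\<close>

lemma factor_down_far:
  assumes "t \<ge> p" "0 \<le> a" "0 \<le> b" "0 \<le> c" "0 \<le> d" "c \<le> n" "d \<le> n" "p - 1 \<le> n"
    and Delta: "Delta_int p (c - a) (d - b) (- t)"
  obtains c' d' where "0 \<le> c'" "c' \<le> n" "0 \<le> d'" "d' \<le> n"
    "D_int p (c - c' - 1) (d - d') \<or> c = c' \<and> d = d'"
    "Delta_int p (c' - a) (d' - b) (- (t - p))"
proof -
  have t: "t \<ge> 0" "t - p \<ge> 0" using assms p_ge_1 by simp_all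
  have 2: "p^2 * (c - a) + (d - b) \<le> p * t" and 3: "p * (c - a + p * (d - b)) \<le> t"
    using Delta t by (auto simp: Delta_int_down_iff)
  \<comment> \<open>For \<open>c = 0\<close> the question is whether \<open>(c, d)\<close> itself
    satisfies the third inequality at height \<open>t - p\<close>.\<close>
  consider "c \<ge> 1" | "c = 0" "p * (p * (d - b) - a) \<le> t - p" | "c = 0" "p * (p * (d - b) - a) > t - p"
    using assms by linarith
  then show thesis
  proof cases
    case 1
    have "Delta_int p (c - 1 - a) (d - b) (- (t - p))"
      using 2 3 t(2)
      by (simp only: Delta_int_down_iff) (simp add: algebra_simps power2_eq_square)
    then show thesis
      using 1 assms by (intro that[of "c - 1" d]) (auto simp: D_int_def)
  next
    case 2
    \<comment> \<open>Here the third inequality implies the second: \<open>a\<close> and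
      \<open>t - p\<close> are nonnegative, so a factor \<open>p^3\<close> only enlarges the
      right-hand side.\<close>
    have "p * (p * (d - b)) \<le> p * a + (t - p)" using 2(2) by (simp add: algebra_simps)
    also have "\<dots> \<le> p^3 * (p * a) + p^3 * (t - p)"
      using assms p_ge_1 t by (intro add_mono mult_power_ge) auto
    also have "\<dots> = p * (p * (p^2 * a + p * (t - p)))"
      by (simp add: algebra_simps power2_eq_square power3_eq_cube)
    finally have "d - b \<le> p^2 * a + p * (t - p)" using p_ge_1 by simp
    then have "Delta_int p (c - a) (d - b) (- (t - p))"
      using 2 t(2) by (simp only: Delta_int_down_iff) (simp add: algebra_simps)
    then show thesis using assms by (intro that[of c d]) auto
  next
    case 3
    \<comment> \<open>The intermediate point is \<open>(p - 1, d - 1)\<close>, that is,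
      \<open>(- 1, d)\<close> moved by \<open>(p, - 1)\<close>. Failure of the inequality forces
      \<open>y \<ge> 1\<close>, hence \<open>d \<ge> 1\<close>; the first coordinate is bounded by
      \<open>p - 1 \<le> n\<close>.\<close>
    define y where "y = d - b"
    have third: "p * (p * y - a) \<le> t" using \<open>p * (c - a + p * (d - b)) \<le> t\<close> 3(1) by (simp add: y_def)
    have "0 < p * (p * y - a)" using 3 t by (simp add: y_def)
    then have "p * y - a > 0" using p_pos zero_less_mult_pos by blast
    then have "p * y > 0" using assms by linarith
    then have y: "y \<ge> 1" using zero_less_mult_pos[of p y] p_pos by simp
    have "p * (p * (p * y - a)) \<le> p * t" using third p_ge_1 by (intro mult_left_mono) auto
    \<comment> \<open>This product is exactly the slack between \<open>p\<close> times the third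
      inequality and the second inequality at the new point.\<close>
    moreover have "(p^3 - 1) * (y - 1) \<ge> 0"
      using y p_pos p_power_ge_1[of 3] by (intro mult_nonneg_nonneg) auto
    ultimately have "p^2 * (p - 1 - a) + (y - 1) \<le> p * (t - p)"
      by (simp add: algebra_simps power2_eq_square power3_eq_cube)
    moreover have "p * (p - 1 - a + p * (y - 1)) \<le> t - p"
      using third by (simp add: algebra_simps)
    ultimately have "Delta_int p (p - 1 - a) (y - 1) (- (t - p))"
      using t(2) by (simp only: Delta_int_down_iff)
    then have *: "Delta_int p (p - 1 - a) (d - 1 - b) (- (t - p))"
      by (simp add: y_def algebra_simps)
    have "D_int p (- p) 1" using p_power_ge_1[of 3]
      by (simp add: D_int_def power2_eq_square power3_eq_cube)
    then show thesis
      using 3 y assms p_ge_1 * by (intro that[of "p - 1" "d - 1"]) (auto simp: y_def)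
  qed
qed

text \<open>\<open>M\<close> stands for the largest offset in condition (iv). Either the relation
  holds within one plane, and a vertical descent finishes, or \<open>(a, b)\<close> is first raised
  to height \<open>M\<close> by \<open>(0, - p * (M - t))\<close> and (iv) leads down from
  there.\<close>

lemma factor_down_near:
  assumes "0 \<le> t" "t < p" "t \<le> M" "M < p" "0 \<le> d"
    and Delta: "Delta_int p (c - a) (d - b) (- t)"
  obtains "D_int p (c - a) (d - b)"
  | "p * (M - t) \<le> b" "D_int p (c - a - 1) (d - (b - p * (M - t)) - (- (p^2) + p * M))"
proof -
  have 2: "p^2 * (c - a) + (d - b) \<le> p * t" and 3: "p * (c - a + p * (d - b)) \<le> t"
    using Delta assms by (auto simp: Delta_int_down_iff)
  \<comment> \<open>Integrality enters here: a multiple of \<open>p\<close> smaller than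
    \<open>p\<close> is at most 0.\<close>
  have "p * (c - a + p * (d - b)) < p * 1" using 3 assms by linarith
  then have le: "c - a + p * (d - b) \<le> 0" using p_pos by (simp only: mult_less_cancel_left_pos)
  show thesis
  proof (cases "c \<le> a")
    case True
    \<comment> \<open>For \<open>c \<le> a\<close> the first inequality of \<open>D\<close> implies
      the second.\<close>
    have "p * (d - b) \<le> a - c" using le by simp
    also have "\<dots> \<le> p^3 * (a - c)" using True by (intro mult_power_ge) simp
    also have "\<dots> = p * (p^2 * (a - c))" by (simp add: power2_eq_square power3_eq_cube)
    finally have "d - b \<le> p^2 * (a - c)" using p_ge_1 by simp
    then show thesis using le that(1) by (simp add: D_int_def algebra_simps)
  next
    case False
    define x where "x = c - a"
    have x: "x \<ge> 1" using False x_def by simp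
    have y: "d - b \<le> p * t - p^2 * x" using 2 x_def by simp
    \<comment> \<open>As \<open>x \<ge> 1\<close>, the second coordinate drops by at least
      \<open>p^2 - p * t\<close>, which is at least \<open>p * (M - t)\<close>; so \<open>b\<close>
      can be lowered by that much.\<close>
    have "p^2 * 1 \<le> p^2 * x" using x by (intro mult_left_mono) auto
    moreover have "p * M \<le> p * p" using assms p_ge_1 by (intro mult_left_mono) auto
    ultimately have b: "p * (M - t) \<le> b"
      using y assms(5) by (simp add: algebra_simps power2_eq_square)
    have "p * (d - b) \<le> p * (p * t - p^2 * x)" using y p_ge_1 by (intro mult_left_mono) auto
    moreover have "(p^3 - 1) * (x - 1) \<ge> 0"
      using x p_pos p_power_ge_1[of 3] by (intro mult_nonneg_nonneg) auto
    ultimately have "D_int p (x - 1) (d - (b - p * (M - t)) - (- (p^2) + p * M))"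
      using y by (simp add: D_int_def algebra_simps power2_eq_square power3_eq_cube)
    then show thesis using b that(2) by (simp add: x_def)
  qed
qed

end

section \<open>The equivalence between consistency and the four conditions\<close>

theorem theorem4p5:
  fixes p m :: nat
    and n i :: int
    and J :: "int \<Rightarrow> (real \<times> real) set"
    and U :: "(real \<times> real) set"
  assumes "prime p"
    and "m > 0"
    and "3 dvd m"
    and "n = int (m div 3) * (int p - 1)"
    and "U = U_square n"
    and "0 \<le> i" and "i \<le> n"
    and "backward_consistent p n (i + 1) J"
    and "is_ideal (D_cone p) U (J i)"
  shows "consistent_at p n i J \<longleftrightarrow>
     (i + 1 \<le> n \<longrightarrow> J (i + 1) \<subseteq> J i) \<and>
     (i + 1 \<le> n \<longrightarrow> (J i + D_cone p + {(0, - real p)}) \<inter> U \<subseteq> J (i + 1)) \<and>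
     (i + int p \<le> n \<longrightarrow> (J (i + int p) + D_cone p + {(1, 0)}) \<inter> U \<subseteq> J i) \<and>
     (let A = {\<alpha>::int. 1 \<le> \<alpha> \<and> \<alpha> \<le> int p - 1 \<and> i + \<alpha> \<le> n \<and> J (i + \<alpha>) \<noteq> {}} in
        A \<noteq> {} \<longrightarrow>
        (J (i + Max A) + D_cone p + {(1, - ((real p)^2) + real p * real_of_int (Max A))}) \<inter> U
          \<subseteq> J i)"
proof -
  let ?p = "int p"
  have p1: "?p \<ge> 1" using prime_gt_0_nat[OF assms(1)] by simp
  \<comment> \<open>Keeps the point \<open>(p - 1, d - 1)\<close> of \<open>factor_down_far\<close>
    inside the square.\<close>
  have pn: "?p - 1 \<le> n"
  proof -
    have "int (m div 3) \<ge> 1" using assms(2,3) by auto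
    then show ?thesis
      using mult_right_mono[of 1 "int (m div 3)" "?p - 1"] p1 assms(4) by simp
  qed
  have ideal: "is_ideal (D_cone p) (U_square n) (J j)" if "j \<in> {i..n}" for j
    using that assms(5,8,9) unfolding backward_consistent_def by (cases "j = i") auto
  then have sub: "J j \<subseteq> U_square n" if "j \<in> {i..n}" for j
    using that unfolding is_ideal_def by blast
  have in_square: "x \<in> {0..n} \<and> y \<in> {0..n}" if "ipt x y \<in> J j" "j \<in> {i..n}" for x y j
    using sub that ipt_in_U_square_iff by blast
  have above: "ipt c d \<in> J l"
    if "ipt a b \<in> J j" "c \<in> {0..n}" "d \<in> {0..n}" "Delta_int ?p (c - a) (d - b) (l - j)"
      "j \<in> {i+1..n}" "l \<in> {i+1..n}" for a b c d j l
    using assms(8) that ipt_in_U_square_iff unfolding backward_consistent_iff by blast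
  have level: "ipt c d \<in> J j"
    if "ipt a b \<in> J j" "c \<in> {0..n}" "d \<in> {0..n}" "D_int ?p (c - a) (d - b)" "j \<in> {i..n}"
    for a b c d j
    using ideal[OF that(5)] that(1-4) ipt_in_U_square_iff prec_D_cone_iff unfolding is_ideal_def
    by blast
  define A where "A = {\<alpha>::int. 1 \<le> \<alpha> \<and> \<alpha> \<le> ?p - 1 \<and> i + \<alpha> \<le> n \<and> J (i + \<alpha>) \<noteq> {}}"
  define M where "M = Max A"
  have fin: "finite A" by (rule finite_subset[of _ "{1..?p - 1}"]) (auto simp: A_def)
  have M: "1 \<le> M" "M \<le> ?p - 1" "i + M \<le> n" if "A \<noteq> {}"
    using Max_in[OF fin that] unfolding M_def A_def by auto
  \<comment> \<open>The four conditions get names so that they can be restated over the integers;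
    unfolding at the end recovers the goal.\<close>
  define c1 where "c1 \<longleftrightarrow> (i + 1 \<le> n \<longrightarrow> J (i + 1) \<subseteq> J i)"
  define c2 where "c2 \<longleftrightarrow>
    (i + 1 \<le> n \<longrightarrow> (J i + D_cone p + {(0, - real p)}) \<inter> U \<subseteq> J (i + 1))"
  define c3 where "c3 \<longleftrightarrow>
    (i + ?p \<le> n \<longrightarrow> (J (i + ?p) + D_cone p + {(1, 0)}) \<inter> U \<subseteq> J i)"
  define c4 where "c4 \<longleftrightarrow> (A \<noteq> {} \<longrightarrow>
    (J (i + M) + D_cone p + {(1, - ((real p)^2) + real p * real_of_int M)}) \<inter> U \<subseteq> J i)"
  have c2_iff: "c2 \<longleftrightarrow> (i + 1 \<le> n \<longrightarrow> (\<forall>a b c d. ipt a b \<in> J i \<longrightarrow> ipt c d \<in> U_square n \<longrightarrow>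
      D_int ?p (c - a) (d - b + ?p) \<longrightarrow> ipt c d \<in> J (i + 1)))"
    using translate_subset_iff[OF sub[of i], of p 0 "- ?p" "J (i + 1)"] assms(5,7)
    unfolding c2_def by simp
  have c3_iff: "c3 \<longleftrightarrow> (i + ?p \<le> n \<longrightarrow> (\<forall>a b c d. ipt a b \<in> J (i + ?p) \<longrightarrow>
      ipt c d \<in> U_square n \<longrightarrow> D_int ?p (c - a - 1) (d - b) \<longrightarrow> ipt c d \<in> J i))"
    using translate_subset_iff[OF sub[of "i + ?p"], of p 1 0 "J i"] assms(5) p1
    unfolding c3_def by simp
  have c4_iff: "c4 \<longleftrightarrow> (A \<noteq> {} \<longrightarrow> (\<forall>a b c d. ipt a b \<in> J (i + M) \<longrightarrow>
      ipt c d \<in> U_square n \<longrightarrow> D_int ?p (c - a - 1) (d - b - (- (?p^2) + ?p * M)) \<longrightarrow>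
      ipt c d \<in> J i))"
  proof (cases "A = {}")
    case False
    then show ?thesis
      using translate_subset_iff[OF sub[of "i + M"], of p 1 "- (?p^2) + ?p * M" "J i"] assms(5)
        M[OF False]
      unfolding c4_def by simp
  qed (simp add: c4_def)
  have "consistent_at p n i J \<longleftrightarrow> c1 \<and> c2 \<and> c3 \<and> c4"
  proof
    \<comment> \<open>Each condition is an instance of the ideal property for the two levels that it
      links.\<close>
    assume "consistent_at p n i J"
    then have "\<forall>j\<in>{i..n}. \<forall>l\<in>{i..n}. \<forall>a b c d. ipt a b \<in> J j \<longrightarrow> ipt c d \<in> U_square n \<longrightarrow>
        Delta_int ?p (c - a) (d - b) (l - j) \<longrightarrow> ipt c d \<in> J l"
      unfolding consistent_at_def backward_consistent_iff by (rule conjunct2)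
    then have cons: "ipt c d \<in> J l"
      if "ipt a b \<in> J j" "ipt c d \<in> U_square n" "Delta_int ?p (c - a) (d - b) (l - j)"
        "j \<in> {i..n}" "l \<in> {i..n}" for a b c d j l
      using that by blast
    have c1
      unfolding c1_def
    proof (intro impI subsetI)
      fix u assume "i + 1 \<le> n" "u \<in> J (i + 1)"
      moreover from this obtain a b where "u = ipt a b"
        using sub[of "i + 1"] U_squareE[of u n]
        by (meson atLeastAtMost_iff less_add_one less_imp_le subsetD)
      ultimately show "u \<in> J i"
        using cons[of a b "i + 1" a b i] Delta_int_descend[OF p1, of 1] sub[of "i + 1"] assms(7)
        by auto
    qed
    moreover have c2
      unfolding c2_iff using Delta_int_condition_ii[OF p1] cons[of _ _ i _ _ "i + 1"] assms(7)
      by auto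
    moreover have c3
      unfolding c3_iff using Delta_int_condition_iii[OF p1] cons[of _ _ "i + ?p" _ _ i] p1 assms(7)
      by auto
    moreover have c4
      unfolding c4_iff
    proof (intro impI allI)
      fix a b c d
      assume "A \<noteq> {}" and H: "ipt a b \<in> J (i + M)" "ipt c d \<in> U_square n"
        "D_int ?p (c - a - 1) (d - b - (- (?p^2) + ?p * M))"
      then have "Delta_int ?p (c - a) (d - b) (- M)"
        using M by (intro Delta_int_condition_iv[OF p1]) auto
      then show "ipt c d \<in> J i"
        using H M[OF \<open>A \<noteq> {}\<close>] assms(7) by (intro cons[of a b "i + M" c d i]) auto
    qed
    ultimately show "c1 \<and> c2 \<and> c3 \<and> c4" by blast
  next
    assume C: "c1 \<and> c2 \<and> c3 \<and> c4"
    have down: "ipt x y \<in> J i" if "ipt x y \<in> J j" "j \<in> {i+1..n}" for x y j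
    proof -
      \<comment> \<open>Condition (i) starts from level \<open>i + 1\<close>, so the descent to that
        level is made first.\<close>
      have "ipt x y \<in> J (i + 1)"
        using that Delta_int_descend[OF p1, of "j - (i + 1)"] in_square[of x y j]
        by (intro above[of x y j x y "i + 1"]) auto
      then show ?thesis using C that unfolding c1_def by auto
    qed
    have up_case: "ipt c d \<in> J l"
      if H: "ipt a b \<in> J i" "c \<in> {0..n}" "d \<in> {0..n}" "Delta_int ?p (c - a) (d - b) (l - i)"
        "l \<in> {i+1..n}" for a b c d l
    proof -
      have ab: "a \<in> {0..n}" "b \<in> {0..n}" using in_square[OF H(1)] assms(7) by auto
      obtain a' b' where w: "0 \<le> a'" "a' \<le> a" "0 \<le> b'" "b' \<le> b"
        "D_int ?p (a' - a) (b' - b + ?p)" "Delta_int ?p (c - a') (d - b') (l - i - 1)"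
        using factor_up[OF p1, of "l - i" a b c d] H ab by auto
      then have "ipt a' b' \<in> U_square n" using ab ipt_in_U_square_iff by auto
      then have "ipt a' b' \<in> J (i + 1)" using C w(5) H(1,5) unfolding c2_iff by auto
      then show ?thesis
        using w(6) H by (intro above[of a' b' "i + 1" c d l]) (auto simp: algebra_simps)
    qed
    have down_case: "ipt c d \<in> J i"
      if H: "ipt a b \<in> J j" "c \<in> {0..n}" "d \<in> {0..n}" "Delta_int ?p (c - a) (d - b) (i - j)"
        "j \<in> {i+1..n}" for a b c d j
    proof -
      have ab: "a \<in> {0..n}" "b \<in> {0..n}" using in_square[OF H(1)] H(5) by auto
      define t where "t = j - i"
      have t: "Delta_int ?p (c - a) (d - b) (- t)" "t \<ge> 1" "j = i + t" "i + t \<le> n"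
        using H(4,5) by (auto simp: t_def)
      have U: "ipt c d \<in> U_square n" using H ipt_in_U_square_iff by auto
      show ?thesis
      proof (cases "t \<ge> ?p")
        case True
        obtain c' d' where w: "0 \<le> c'" "c' \<le> n" "0 \<le> d'" "d' \<le> n"
          "D_int ?p (c - c' - 1) (d - d') \<or> c = c' \<and> d = d'"
          "Delta_int ?p (c' - a) (d' - b) (- (t - ?p))"
          using factor_down_far[OF p1 True _ _ _ _ _ _ pn t(1)] ab H by auto
        have w_in: "ipt c' d' \<in> J (i + ?p)"
          using w t True p1 H(1) by (intro above[of a b j c' d' "i + ?p"]) auto
        from w(5) show ?thesis
        proof
          assume "D_int ?p (c - c' - 1) (d - d')"
          then show ?thesis using C w_in U t True unfolding c3_iff by auto
        next
          assume "c = c' \<and> d = d'"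
          then show ?thesis using down[of c d "i + ?p"] w_in t True p1 by auto
        qed
      next
        case False
        \<comment> \<open>The point \<open>(a, b)\<close> shows that level \<open>i + t\<close> is
          nonempty, so condition (iv) is not void and its offset is at least
          \<open>t\<close>.\<close>
        then have tA: "t \<in> A" using t H(1) unfolding A_def by auto
        then have "A \<noteq> {}" and "t \<le> M" using fin unfolding M_def by auto
        note M = M[OF this(1)]
        have near: "0 \<le> t" "t < ?p" "M < ?p" "0 \<le> d" using t False M H by auto
        from p1 near(1,2) \<open>t \<le> M\<close> near(3,4) t(1) show ?thesis
        proof (cases rule: factor_down_near)
          case 1
          then have "ipt c d \<in> J j" using level[OF H(1-3)] H(5) by auto
          then show ?thesis using down H(5) by blast
        next
          case 2
          let ?b = "b - ?p * (M - t)"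
          have "?p * (M - t) \<ge> 0" using \<open>t \<le> M\<close> by simp
          \<comment> \<open>Lowering the second coordinate by \<open>p\<close> per level makes both
            upward inequalities equalities.\<close>
          moreover have "Delta_int ?p (a - a) (?b - b) (M - t)"
            using \<open>t \<le> M\<close> by (simp add: Delta_int_up_iff[OF p1] power2_eq_square)
          ultimately have "ipt a ?b \<in> J (i + M)"
            using 2(1) ab t M H(1) by (intro above[of a b j a ?b "i + M"]) auto
          then show ?thesis using C 2(2) U \<open>A \<noteq> {}\<close> unfolding c4_iff by blast
        qed
      qed
    qed
    show "consistent_at p n i J"
      unfolding consistent_at_def backward_consistent_iff
    proof (intro conjI ballI allI impI)
      fix j l a b c d
      assume H: "j \<in> {i..n}" "l \<in> {i..n}" "ipt a b \<in> J j" "ipt c d \<in> U_square n"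
        "Delta_int ?p (c - a) (d - b) (l - j)"
      have cd: "c \<in> {0..n}" "d \<in> {0..n}" using H(4) ipt_in_U_square_iff by auto
      consider "j = i" "l = i" | "j = i" "l \<in> {i+1..n}" | "j \<in> {i+1..n}" "l = i"
        | "j \<in> {i+1..n}" "l \<in> {i+1..n}"
        using H(1,2) by force
      then show "ipt c d \<in> J l"
      proof cases
        case 1
        then show ?thesis
          using level[of a b i c d] H cd Delta_int_level_iff[OF p1] by simp
      next
        case 2
        then show ?thesis using up_case[of a b c d l] H cd by simp
      next
        case 3
        then show ?thesis using down_case[of a b j c d] H cd by simp
      next
        case 4
        then show ?thesis using above[of a b j c d l] H cd by blast
      qed
    qed (use ideal in blast)
  qed
  then show ?thesis
    unfolding c1_def c2_def c3_def c4_def M_def A_def Let_def .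
qed

end
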